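(* Let $R$ be a unitary commutative ring, let $G^\delta$ and $H^\delta$ be weighted directed hypergraphs with weights in $R$, and let $f^e,g^e\colon G^{\delta}\to H^{\delta}$ be homotopic edge-weighted morphisms. Assume that all elements of the set $$\mathbb K=\{k\in R\mid k=|A|,\ A\in\mathbf P_{01}(G)\}$$ are invertible in $R$. Then the induced homomorphisms $$f_*,g_*\colon H^{\mathbf e}_*(G,R)\to H^{\mathbf e}_*(H,R)$$ of edge-weighted path homology groups coincide.
   Context: All hypergraphs, digraphs and path complexes are finite; $R$ is a unitary commutative ring. Directed hypergraphs. A directed hypergraph $G=(V,E)$ is a finite set $V$ of vertices and a set $E$ of arrows, each arrow being an ordered pair $(A,B)$, written $A\to B$, of disjoint non-empty subsets of $V$, with $V=\bigcup_{(A\to B)\in E}(A\cup B)$. A morphism $f\colon G\to H$ is a pair of maps $f_V\colon V_G\to V_H$, $f_E\colon E_G\to E_H$ with $f_E(A\to B)=(f_V(A)\to f_V(B))$ for all $(A\to B)\in E_G$. A weighted directed hypergraph $G^\delta=(V,E,\delta_V)$ carries a function $\delta_V\colon V\to R$; for $X\subset V$ put $|X|=\sum_{x\in X}\delta_V(x)\in R$. A morphism $f$ between weighted directed hypergraphs is edge-weighted if for every $(A\to B)\in E_G$ with $f_E(A\to B)=(A'\to B')$ one has $|A|=|A'|$ and $|B|=|B'|$. $\mathbf P_{01}(G)$ is the set of all non-empty subsets of $V_G$ which are the origin $A$ or the end $B$ of some arrow $(A\to B)\in E_G$. Homotopy. $I_1$ denotes either of the two digraphs $0\to1$ and $1\to0$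 on $\{0,1\}$. The box product $G\Box I_1$ is the directed hypergraph with vertex set $V_G\times\{0,1\}$ and arrows $A\times\{i\}\to B\times\{i\}$ for $(A\to B)\in E_G$, $i\in\{0,1\}$, and $A\times\{i\}\to A\times\{j\}$ for $A\in\mathbf P_{01}(G)$, $(i\to j)$ the arrow of $I_1$. Morphisms $f_0,f_1\colon G\to H$ are one-step homotopic if for one of the two choices of $I_1$ there is a morphism $F\colon G\Box I_1\to H$ with $F|_{G\Box\{0\}}=f_0$, $F|_{G\Box\{1\}}=f_1$. Edge-weighted morphisms $f,g\colon G^\delta\to H^\delta$ are homotopic if there is a sequence of edge-weighted morphisms $f=f_0,f_1,\dots,f_n=g\colon G^\delta\to H^\delta$ with consecutive ones one-step homotopic. Weighted path complexes and their homology. A path complex $\Pi=(V,P)$ is a set $V$ with a set $P$ of finite sequences $(i_0\dots i_n)$, $n\geq 0$, of elements of $V$ such that all $(i)\in P$ and $(i_0\dots i_n)\in P$, $n\ge1$, implies $(i_0\dots i_{n-1}),(i_1\dots i_n)\in P$. A weighted path complex $\Pi^\delta=(V,P,\delta_V)$ carries $\delta_V\colon V\to R$; a weighted morphism is a map of vertices sending paths to paths and preserving weights. A path is regular if consecutive vertices are distinct. $\mathcal R_n^{reg}(V)$ ($n\ge0$) is the free $R$-module on regular paths $e_{i_0\dots i_n}$ on $V$ (non-regular $e_{i_0\dots i_n}$ are set to be $0$), $\mathcal R_n^{reg}(P)$ is the submodule generated by regular paths in $P$, $\mathcal R^{reg}_{-1}=0$. Put $\partial^w_0=0$, $\partial^w_n(e_{i_0\dots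 i_n})=\sum_{s=0}^n(-1)^s\delta_V(i_s)e_{i_0\dots\widehat{i_s}\dots i_n}$ for $n\ge1$; then $(\partial^w)^2=0$. Put $\Omega_{-1}^w=0$ and $\Omega^w_n(\Pi^\delta)=\{v\in\mathcal R^{reg}_n(P)\mid\partial^wv\in\mathcal R^{reg}_{n-1}(P)\}$ for $n\geq 0$; $H^{\mathbf w}_*(\Pi^\delta)$ is the homology of $(\Omega^w_*,\partial^w)$. A weighted morphism induces homomorphisms by $e_{i_0\dots i_n}\mapsto e_{f(i_0)\dots f(i_n)}$. Edge-weighted path homology. For a weighted directed hypergraph $G^\delta$, $\mathfrak N^w(G)$ is the weighted digraph with vertex set $\mathbf P_{01}(G)$, arrows $A\to B$ for $(A\to B)\in E_G$, and weight of a vertex $A$ equal to $|A|$. For a weighted digraph $D$ without loops, $\mathfrak D^w(D)$ is the weighted path complex on the vertices of $D$ (with the same weights) whose paths are the sequences $(i_0\dots i_n)$ such that $i_{k-1}\to i_k$ is an arrow of $D$ for $k=1,\dots,n$. Define $H^{\mathbf e}_*(G,R)=H^{\mathbf w}_*(\mathfrak D^w(\mathfrak N^w(G)))$. An edge-weighted morphism $f$ induces the weighted morphism $\mathfrak D^w\mathfrak N^w(G)\to\mathfrak D^w\mathfrak N^w(H)$ given on vertices by $C\mapsto f_V(C)$, and hence $f_*$ on $H^{\mathbf e}_*$. *)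

theory Defs
  imports Main "HOL-Library.FuncSet" "HOL-Library.Poly_Mapping" "HOL-Algebra.Coset"
begin

text \<open>
  The coefficient ring is a type of sort \<open>{comm_ring, comm_monoid_mult}\<close>: a commutative ring
  with unit.  The class \<open>comm_ring_1\<close> would in addition exclude the zero ring.
\<close>

section \<open>Directed hypergraphs\<close>

record 'a dir_hypergraph =
  hverts :: "'a set"
  harrows :: "('a set \<times> 'a set) set"

record ('a, 'r) wdir_hypergraph = "'a dir_hypergraph" +
  hweight :: "'a \<Rightarrow> 'r"

definition directed_hypergraph :: "('a, 'z) dir_hypergraph_scheme \<Rightarrow> bool" where
  "directed_hypergraph G \<longleftrightarrow>
     finite (hverts G) \<and>
     (\<forall>(A, B) \<in> harrows G. A \<noteq> {} \<and> B \<noteq> {} \<and> A \<inter> B = {}) \<and>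
     hverts G = (\<Union>(A, B) \<in> harrows G. A \<union> B)"

definition P01 :: "('a, 'z) dir_hypergraph_scheme \<Rightarrow> 'a set set" where
  "P01 G = fst ` harrows G \<union> snd ` harrows G"

definition set_weight :: "('a, 'r::comm_monoid_add) wdir_hypergraph \<Rightarrow> 'a set \<Rightarrow> 'r" where
  "set_weight G X = (\<Sum>x\<in>X. hweight G x)"

text \<open>
  A morphism is the pair of its vertex map and its arrow map.  Both are extensional functions on
  their domains, so that HOL equality of pairs is equality of morphisms.
\<close>

type_synonym ('a, 'b) hmap = "('a \<Rightarrow> 'b) \<times> ('a set \<times> 'a set \<Rightarrow> 'b set \<times> 'b set)"

definition hmorphism ::
  "('a, 'y) dir_hypergraph_scheme \<Rightarrow> ('b, 'z) dir_hypergraph_scheme \<Rightarrow> ('a, 'b) hmap \<Rightarrow> bool" where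
  "hmorphism G H f \<longleftrightarrow>
     fst f \<in> hverts G \<rightarrow>\<^sub>E hverts H \<and>
     snd f \<in> harrows G \<rightarrow>\<^sub>E harrows H \<and>
     (\<forall>(A, B) \<in> harrows G. snd f (A, B) = (fst f ` A, fst f ` B))"

definition edge_weighted_morphism ::
  "('a, 'r::comm_monoid_add) wdir_hypergraph \<Rightarrow> ('b, 'r) wdir_hypergraph \<Rightarrow> ('a, 'b) hmap \<Rightarrow> bool" where
  "edge_weighted_morphism G H f \<longleftrightarrow>
     hmorphism G H f \<and>
     (\<forall>(A, B) \<in> harrows G. \<forall>A' B'. snd f (A, B) = (A', B') \<longrightarrow>
        set_weight G A = set_weight H A' \<and> set_weight G B = set_weight H B')"

section \<open>Homotopy\<close>

text \<open>\<open>box_I G (i, j)\<close> is the box product of \<open>G\<close> with the digraph on \<open>{0, 1}\<close> whose only arrow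
  is \<open>i \<rightarrow> j\<close>; it is used for \<open>(i, j) = (0, 1)\<close> and \<open>(i, j) = (1, 0)\<close>.\<close>

definition box_I ::
  "('a, 'z) dir_hypergraph_scheme \<Rightarrow> nat \<times> nat \<Rightarrow> ('a \<times> nat) dir_hypergraph" where
  "box_I G = (\<lambda>(i, j).
     \<lparr> hverts = hverts G \<times> {0, 1},
       harrows = {(A \<times> {k}, B \<times> {k}) | A B k. (A, B) \<in> harrows G \<and> k \<in> {0, 1}}
               \<union> {(A \<times> {i}, A \<times> {j}) | A. A \<in> P01 G} \<rparr>)"

text \<open>The restriction to \<open>G \<box> {k}\<close>, which is identified with \<open>G\<close>.\<close>

definition box_restrict ::
  "('a, 'z) dir_hypergraph_scheme \<Rightarrow> nat \<Rightarrow> ('a \<times> nat, 'b) hmap \<Rightarrow> ('a, 'b) hmap" where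
  "box_restrict G k F =
     (\<lambda>v\<in>hverts G. fst F (v, k), \<lambda>(A, B)\<in>harrows G. snd F (A \<times> {k}, B \<times> {k}))"

definition one_step_homotopic ::
  "('a, 'y) dir_hypergraph_scheme \<Rightarrow> ('b, 'z) dir_hypergraph_scheme \<Rightarrow>
     ('a, 'b) hmap \<Rightarrow> ('a, 'b) hmap \<Rightarrow> bool" where
  "one_step_homotopic G H f0 f1 \<longleftrightarrow>
     (\<exists>I \<in> {(0, 1), (1, 0)}. \<exists>F. hmorphism (box_I G I) H F \<and>
        box_restrict G 0 F = f0 \<and> box_restrict G 1 F = f1)"

definition edge_weighted_homotopic ::
  "('a, 'r::comm_monoid_add) wdir_hypergraph \<Rightarrow> ('b, 'r) wdir_hypergraph \<Rightarrow>
     ('a, 'b) hmap \<Rightarrow> ('a, 'b) hmap \<Rightarrow> bool" where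
  "edge_weighted_homotopic G H f g \<longleftrightarrow>
     (\<exists>n (h :: nat \<Rightarrow> ('a, 'b) hmap).
        h 0 = f \<and> h n = g \<and>
        (\<forall>i\<le>n. edge_weighted_morphism G H (h i)) \<and>
        (\<forall>i<n. one_step_homotopic G H (h i) (h (Suc i))))"

section \<open>Weighted path complexes and their homology\<close>

text \<open>A path \<open>(i\<^sub>0 \<dots> i\<^sub>n)\<close> is a list of length \<open>n + 1\<close>.\<close>

record ('v, 'r) wpath_complex =
  pverts :: "'v set"
  ppaths :: "'v list set"
  pweight :: "'v \<Rightarrow> 'r"

definition path_complex :: "('v, 'r) wpath_complex \<Rightarrow> bool" where
  "path_complex C \<longleftrightarrow>
     finite (pverts C) \<and>
     (\<forall>p \<in> ppaths C. p \<noteq> [] \<and> set p \<subseteq> pverts C) \<and>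
     (\<forall>v \<in> pverts C. [v] \<in> ppaths C) \<and>
     (\<forall>p \<in> ppaths C. length p \<ge> 2 \<longrightarrow> butlast p \<in> ppaths C \<and> tl p \<in> ppaths C)"

definition weighted_path_morphism ::
  "('v, 'r) wpath_complex \<Rightarrow> ('w, 'r) wpath_complex \<Rightarrow> ('v \<Rightarrow> 'w) \<Rightarrow> bool" where
  "weighted_path_morphism C D \<phi> \<longleftrightarrow>
     \<phi> \<in> pverts C \<rightarrow> pverts D \<and>
     (\<forall>p \<in> ppaths C. map \<phi> p \<in> ppaths D) \<and>
     (\<forall>v \<in> pverts C. pweight D (\<phi> v) = pweight C v)"

definition chain_scale :: "'r \<Rightarrow> ('p \<Rightarrow>\<^sub>0 'r) \<Rightarrow> ('p \<Rightarrow>\<^sub>0 'r::comm_ring)" where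
  "chain_scale r c = Poly_Mapping.map (\<lambda>x. r * x) c"

definition chain_extend :: "('p \<Rightarrow> ('q \<Rightarrow>\<^sub>0 'r)) \<Rightarrow> ('p \<Rightarrow>\<^sub>0 'r) \<Rightarrow> ('q \<Rightarrow>\<^sub>0 'r::comm_ring)" where
  "chain_extend \<phi> c = (\<Sum>p \<in> Poly_Mapping.keys c. chain_scale (Poly_Mapping.lookup c p) (\<phi> p))"

text \<open>The basis element \<open>e\<^sub>p\<close>; it is \<open>0\<close> for a path that is not regular.\<close>

definition path_elem :: "'v list \<Rightarrow> ('v list \<Rightarrow>\<^sub>0 'r::{comm_ring, comm_monoid_mult})" where
  "path_elem p = (if distinct_adj p then Poly_Mapping.single p 1 else 0)"

text \<open>The submodule generated by the regular paths of length \<open>n\<close> in \<open>P\<close>.\<close>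

definition reg_chains ::
  "nat \<Rightarrow> 'v list set \<Rightarrow> ('v list \<Rightarrow>\<^sub>0 'r::{comm_ring, comm_monoid_mult}) set" where
  "reg_chains n P = {c. Poly_Mapping.keys c \<subseteq> {p \<in> P. length p = Suc n \<and> distinct_adj p}}"

definition wboundary ::
  "('v \<Rightarrow> 'r) \<Rightarrow> nat \<Rightarrow> ('v list \<Rightarrow>\<^sub>0 'r) \<Rightarrow> ('v list \<Rightarrow>\<^sub>0 'r::{comm_ring, comm_monoid_mult})" where
  "wboundary \<delta> n c =
     (if n = 0 then 0
      else chain_extend
        (\<lambda>p. \<Sum>s\<le>n. chain_scale ((- 1) ^ s * \<delta> (p ! s)) (path_elem (take s p @ drop (Suc s) p))) c)"

text \<open>In degree \<open>0\<close> the condition on the boundary is void, because \<open>\<partial>\<^sub>0 = 0\<close>.\<close>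

definition Omega ::
  "('v, 'r) wpath_complex \<Rightarrow> nat \<Rightarrow> ('v list \<Rightarrow>\<^sub>0 'r::{comm_ring, comm_monoid_mult}) set" where
  "Omega C n =
     {v \<in> reg_chains n (ppaths C).
        n > 0 \<longrightarrow> wboundary (pweight C) n v \<in> reg_chains (n - 1) (ppaths C)}"

definition cycle_group ::
  "('v, 'r) wpath_complex \<Rightarrow> nat \<Rightarrow> ('v list \<Rightarrow>\<^sub>0 'r::{comm_ring, comm_monoid_mult}) monoid" where
  "cycle_group C n =
     \<lparr> carrier = {v \<in> Omega C n. wboundary (pweight C) n v = 0}, monoid.mult = (+), one = 0 \<rparr>"

definition boundaries ::
  "('v, 'r) wpath_complex \<Rightarrow> nat \<Rightarrow> ('v list \<Rightarrow>\<^sub>0 'r::{comm_ring, comm_monoid_mult}) set" where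
  "boundaries C n = wboundary (pweight C) (Suc n) ` Omega C (Suc n)"

definition path_homology ::
  "('v, 'r) wpath_complex \<Rightarrow> nat \<Rightarrow> ('v list \<Rightarrow>\<^sub>0 'r::{comm_ring, comm_monoid_mult}) set monoid" where
  "path_homology C n = cycle_group C n Mod boundaries C n"

definition chain_push ::
  "('v \<Rightarrow> 'w) \<Rightarrow> ('v list \<Rightarrow>\<^sub>0 'r) \<Rightarrow> ('w list \<Rightarrow>\<^sub>0 'r::{comm_ring, comm_monoid_mult})" where
  "chain_push \<phi> = chain_extend (\<lambda>p. path_elem (map \<phi> p))"

text \<open>
  The map \<open>[z] \<mapsto> [\<phi>\<^sub># z]\<close> on homology classes.  For a weighted morphism \<open>\<phi>\<close> all representatives
  \<open>z\<close> of a class yield the same coset, so the union is over equal cosets.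
\<close>

definition path_homology_map ::
  "('v, 'r) wpath_complex \<Rightarrow> ('w, 'r) wpath_complex \<Rightarrow> ('v \<Rightarrow> 'w) \<Rightarrow> nat \<Rightarrow>
     ('v list \<Rightarrow>\<^sub>0 'r) set \<Rightarrow> ('w list \<Rightarrow>\<^sub>0 'r::{comm_ring, comm_monoid_mult}) set" where
  "path_homology_map C D \<phi> n =
     (\<lambda>X \<in> carrier (path_homology C n).
        \<Union>z\<in>X. boundaries D n #>\<^bsub>cycle_group D n\<^esub> chain_push \<phi> z)"

section \<open>Edge-weighted path homology\<close>

record ('v, 'r) wdigraph =
  dverts :: "'v set"
  darcs :: "('v \<times> 'v) set"
  dweight :: "'v \<Rightarrow> 'r"

definition Nw :: "('a, 'r::comm_monoid_add) wdir_hypergraph \<Rightarrow> ('a set, 'r) wdigraph" where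
  "Nw G = \<lparr> dverts = P01 G, darcs = harrows G, dweight = set_weight G \<rparr>"

definition Dw :: "('v, 'r) wdigraph \<Rightarrow> ('v, 'r) wpath_complex" where
  "Dw D =
     \<lparr> pverts = dverts D,
       ppaths = {p. p \<noteq> [] \<and> set p \<subseteq> dverts D \<and> successively (\<lambda>x y. (x, y) \<in> darcs D) p},
       pweight = dweight D \<rparr>"

definition edge_homology ::
  "('a, 'r) wdir_hypergraph \<Rightarrow> nat \<Rightarrow>
     ('a set list \<Rightarrow>\<^sub>0 'r::{comm_ring, comm_monoid_mult}) set monoid" where
  "edge_homology G n = path_homology (Dw (Nw G)) n"

definition edge_homology_map ::
  "('a, 'r) wdir_hypergraph \<Rightarrow> ('b, 'r) wdir_hypergraph \<Rightarrow> ('a, 'b) hmap \<Rightarrow> nat \<Rightarrow>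
     ('a set list \<Rightarrow>\<^sub>0 'r) set \<Rightarrow> ('b set list \<Rightarrow>\<^sub>0 'r::{comm_ring, comm_monoid_mult}) set" where
  "edge_homology_map G H f n = path_homology_map (Dw (Nw G)) (Dw (Nw H)) (\<lambda>C. fst f ` C) n"

lemma Nw_loopfree:
  assumes "directed_hypergraph G"
  shows "(A, A) \<notin> darcs (Nw G)"
  using assms by (auto simp: directed_hypergraph_def Nw_def)

lemma path_complex_Dw_Nw:
  assumes "directed_hypergraph G"
  shows "path_complex (Dw (Nw G))"
proof -
  have V: "finite (hverts G)" and U: "hverts G = (\<Union>(A, B) \<in> harrows G. A \<union> B)"
    using assms unfolding directed_hypergraph_def by blast+
  have "P01 G \<subseteq> Pow (hverts G)"
    unfolding P01_def by (subst U) force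
  then have fin: "finite (P01 G)"
    using V by (meson finite_Pow_iff finite_subset)
  let ?S = "P01 G" and ?Q = "\<lambda>x y. (x, y) \<in> harrows G"
  have step: "butlast p \<noteq> [] \<and> set (butlast p) \<subseteq> ?S \<and> successively ?Q (butlast p)
       \<and> tl p \<noteq> [] \<and> set (tl p) \<subseteq> ?S \<and> successively ?Q (tl p)"
    if len: "length p \<ge> 2" and "set p \<subseteq> ?S" and suc: "successively ?Q p"
    for p
  proof -
    obtain x r where x: "p = x # r"
      using len by (cases p) auto
    obtain y q where "r = y # q"
      using len x by (cases r) auto
    then have p: "p = x # y # q"
      by (simp add: x)
    have "successively ?Q (butlast p @ [last p])"
      using suc p by simp
    then have "successively ?Q (butlast p)"
      by (simp add: successively_append_iff)
    then show ?thesis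
      using that p by (auto dest: in_set_butlastD)
  qed
  show ?thesis
    unfolding path_complex_def Dw_def Nw_def using fin step by simp
qed

lemma weighted_path_morphism_Dw_Nw:
  assumes "edge_weighted_morphism G H f"
  shows "weighted_path_morphism (Dw (Nw G)) (Dw (Nw H)) (\<lambda>C. fst f ` C)"
proof -
  have mor: "hmorphism G H f"
    using assms by (simp add: edge_weighted_morphism_def)
  have img: "snd f (A, B) = (fst f ` A, fst f ` B)" if "(A, B) \<in> harrows G" for A B
    using mor that by (auto simp: hmorphism_def)
  have arr: "(fst f ` A, fst f ` B) \<in> harrows H" if "(A, B) \<in> harrows G" for A B
  proof -
    have "snd f \<in> harrows G \<rightarrow>\<^sub>E harrows H"
      using mor by (simp add: hmorphism_def)
    then have "snd f (A, B) \<in> harrows H"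
      using that by (rule PiE_mem)
    then show ?thesis by (simp add: img that)
  qed
  have wt: "set_weight H (fst f ` A) = set_weight G A \<and> set_weight H (fst f ` B) = set_weight G B"
    if "(A, B) \<in> harrows G" for A B
    using assms that img[OF that] by (auto simp: edge_weighted_morphism_def)
  have P01E: "\<exists>A B. (A, B) \<in> harrows G \<and> (C = A \<or> C = B)" if "C \<in> P01 G" for C
    using that unfolding P01_def by force
  have P01I: "A \<in> P01 H \<and> B \<in> P01 H" if "(A, B) \<in> harrows H" for A B
    using that unfolding P01_def by force
  have verts: "fst f ` C \<in> P01 H" if "C \<in> P01 G" for C
    using P01E[OF that] P01I arr by metis
  have weight: "set_weight H (fst f ` C) = set_weight G C" if "C \<in> P01 G" for C
    using P01E[OF that] wt by metis
  have "successively (\<lambda>x y. (fst f ` x, fst f ` y) \<in> harrows H) p"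
    if "successively (\<lambda>x y. (x, y) \<in> harrows G) p" for p
    using that by (rule successively_mono) (auto intro: arr)
  then show ?thesis
    using verts weight unfolding weighted_path_morphism_def Dw_def Nw_def
    by (auto simp: successively_map)
qed

end

theory Submission imports Defs begin

text \<open>
  A one-step homotopy between \<open>\<phi>\<close> and \<open>\<psi>\<close> provides an arrow \<open>\<phi> A \<rightarrow> \<psi> A\<close> for every \<open>A\<close> (after exchanging
  \<open>\<phi>\<close> and \<open>\<psi>\<close> if necessary), so that the prism operator
  \<open>L (v\<^sub>0 \<dots> v\<^sub>n) = \<Sum>s. (- 1) ^ s * (1 / \<delta> v\<^sub>s) * (\<phi> v\<^sub>0 \<dots> \<phi> v\<^sub>s \<psi> v\<^sub>s \<dots> \<psi> v\<^sub>n)\<close>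
  stays within the paths of the target.  As the weights are preserved and invertible,
  \<open>\<partial> L + L \<partial> = \<psi> - \<phi>\<close>.  This identity is obtained for arbitrary lists, regular or not, by
  induction on the list, and descends to regular chains because \<open>\<partial>\<close> and \<open>L\<close> map degenerate
  chains to degenerate ones.  Hence the two images of a cycle \<open>z\<close> differ by the boundary of \<open>L z\<close>.
\<close>

section \<open>Chains\<close>

abbreviation basis :: "'p \<Rightarrow> ('p \<Rightarrow>\<^sub>0 'r::{comm_ring, comm_monoid_mult})" where
  "basis p \<equiv> Poly_Mapping.single p 1"

lemma lookup_chain_scale [simp]:
  "Poly_Mapping.lookup (chain_scale r c) p = r * Poly_Mapping.lookup c p"
  by (simp add: chain_scale_def Poly_Mapping.map.rep_eq when_def)

lemma chain_scale_zero [simp]: "chain_scale r 0 = 0"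
  and chain_scale_0 [simp]: "chain_scale 0 c = 0"
  and chain_scale_add: "chain_scale r (a + b) = chain_scale r a + chain_scale r b"
  and chain_scale_diff: "chain_scale r (a - b) = chain_scale r a - chain_scale r b"
  and chain_scale_add_left: "chain_scale (r + s) a = chain_scale r a + chain_scale s a"
  and chain_scale_scale: "chain_scale r (chain_scale s a) = chain_scale (r * s) a"
  by (rule poly_mapping_eqI; simp add: lookup_add lookup_minus algebra_simps)+

lemma chain_scale_uminus_left: "chain_scale (- r) a = - chain_scale r a"
  by (rule poly_mapping_eqI) simp

lemma chain_scale_one [simp]:
  "chain_scale 1 (a :: 'p \<Rightarrow>\<^sub>0 'r::{comm_ring, comm_monoid_mult}) = a"
  by (rule poly_mapping_eqI) simp

lemma chain_scale_sum: "chain_scale r (\<Sum>i\<in>A. f i) = (\<Sum>i\<in>A. chain_scale r (f i))"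
  by (induction A rule: infinite_finite_induct) (auto simp: chain_scale_add)

text \<open>Terms outside the support have coefficient 0, so chains with different supports can be
  summed over one common index set.\<close>

lemma chain_extend_superset:
  assumes "finite A" "Poly_Mapping.keys c \<subseteq> A"
  shows "chain_extend \<phi> c = (\<Sum>p\<in>A. chain_scale (Poly_Mapping.lookup c p) (\<phi> p))"
  unfolding chain_extend_def
  using assms by (intro sum.mono_neutral_left) (auto simp: in_keys_iff)

lemma chain_extend_add: "chain_extend \<phi> (a + b) = chain_extend \<phi> a + chain_extend \<phi> b"
proof -
  let ?A = "Poly_Mapping.keys a \<union> Poly_Mapping.keys b"
  have "Poly_Mapping.keys (a + b) \<subseteq> ?A" by (rule Poly_Mapping.keys_add)
  then show ?thesis
    by (simp add: chain_extend_superset[of ?A] lookup_add chain_scale_add_left sum.distrib)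
qed

lemma chain_extend_zero [simp]: "chain_extend \<phi> 0 = 0"
  by (simp add: chain_extend_def)

lemma chain_extend_scale: "chain_extend \<phi> (chain_scale r a) = chain_scale r (chain_extend \<phi> a)"
proof -
  have "Poly_Mapping.keys (chain_scale r a) \<subseteq> Poly_Mapping.keys a"
    by (auto simp: in_keys_iff)
  then show ?thesis
    by (simp add: chain_extend_superset[of "Poly_Mapping.keys a"] chain_scale_sum chain_scale_scale)
qed

lemma chain_extend_uminus: "chain_extend \<phi> (- a) = - chain_extend \<phi> a"
  using chain_extend_add[of \<phi> a "- a"] by (simp add: eq_neg_iff_add_eq_0 add.commute)

lemma chain_extend_diff: "chain_extend \<phi> (a - b) = chain_extend \<phi> a - chain_extend \<phi> b"
  using chain_extend_add[of \<phi> a "- b"] by (simp add: chain_extend_uminus)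

lemma chain_extend_sum: "chain_extend \<phi> (\<Sum>i\<in>A. f i) = (\<Sum>i\<in>A. chain_extend \<phi> (f i))"
  by (induction A rule: infinite_finite_induct) (auto simp: chain_extend_add)

lemma chain_extend_basis [simp]:
  "chain_extend \<phi> (basis p :: 'p \<Rightarrow>\<^sub>0 'r::{comm_ring, comm_monoid_mult}) = \<phi> p"
  by (subst chain_extend_superset[of "{p}"]) auto

lemmas chain_linear = chain_extend_add chain_extend_diff chain_extend_scale chain_extend_sum
  chain_scale_add chain_scale_diff chain_scale_scale chain_scale_sum

text \<open>A chain is the sum of its scaled basis elements. The basis case runs only over the
  support of the given \<open>c\<close>, so facts about that support are available there.\<close>

lemma chain_induct [case_names zero basis add]:
  fixes c :: "'p \<Rightarrow>\<^sub>0 'r::{comm_ring, comm_monoid_mult}"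
  assumes zero: "Q 0"
    and basis: "\<And>p r. p \<in> Poly_Mapping.keys c \<Longrightarrow> Q (chain_scale r (basis p))"
    and add: "\<And>a b. Q a \<Longrightarrow> Q b \<Longrightarrow> Q (a + b)"
  shows "Q c"
proof -
  have "c = (\<Sum>p\<in>Poly_Mapping.keys c. chain_scale (Poly_Mapping.lookup c p) (basis p))"
    by (rule poly_mapping_eqI)
      (simp add: lookup_sum lookup_single when_def if_distrib in_keys_iff cong: if_cong)
  also have "Q \<dots>"
  proof -
    have "Q (\<Sum>p\<in>A. chain_scale (Poly_Mapping.lookup c p) (basis p))"
      if "finite A" "A \<subseteq> Poly_Mapping.keys c" for A
      using that by (induction A) (auto intro: zero basis add)
    then show ?thesis by simp
  qed
  finally show ?thesis .
qed

lemma chain_extend_comp: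
  fixes c :: "'p \<Rightarrow>\<^sub>0 'r::{comm_ring, comm_monoid_mult}"
  shows "chain_extend \<phi> (chain_extend \<psi> c) = chain_extend (\<lambda>p. chain_extend \<phi> (\<psi> p)) c"
  by (induction c rule: chain_induct) (simp_all add: chain_linear)

section \<open>Supports of chains\<close>

lemma keys_chain_scale: "Poly_Mapping.keys (chain_scale r c) \<subseteq> Poly_Mapping.keys c"
  by (auto simp: in_keys_iff)

lemma keys_chain_add:
  "Poly_Mapping.keys a \<subseteq> S \<Longrightarrow> Poly_Mapping.keys b \<subseteq> S \<Longrightarrow> Poly_Mapping.keys (a + b) \<subseteq> S"
  using Poly_Mapping.keys_add[of a b] by blast

lemma keys_chain_uminus:
  "Poly_Mapping.keys (- a :: 'p \<Rightarrow>\<^sub>0 'r::ab_group_add) = Poly_Mapping.keys a"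
  by (auto simp: in_keys_iff)

lemma keys_chain_diff:
  fixes a b :: "'p \<Rightarrow>\<^sub>0 'r::ab_group_add"
  shows "Poly_Mapping.keys a \<subseteq> S \<Longrightarrow> Poly_Mapping.keys b \<subseteq> S \<Longrightarrow> Poly_Mapping.keys (a - b) \<subseteq> S"
  using keys_chain_add[of a S "- b"] by (simp add: keys_chain_uminus)

lemma keys_chain_extend:
  fixes c :: "'p \<Rightarrow>\<^sub>0 'r::{comm_ring, comm_monoid_mult}"
  assumes "\<And>p. p \<in> Poly_Mapping.keys c \<Longrightarrow> Poly_Mapping.keys (\<phi> p) \<subseteq> S"
  shows "Poly_Mapping.keys (chain_extend \<phi> c) \<subseteq> S"
proof (induction c rule: chain_induct)
  case (basis p r)
  then show ?case
    using assms[of p] keys_chain_scale[of r "\<phi> p"] by (simp add: chain_linear)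
qed (simp_all add: chain_linear keys_chain_add)

section \<open>Formal boundary and prism operators\<close>

definition cons_chain ::
  "'v \<Rightarrow> ('v list \<Rightarrow>\<^sub>0 'r) \<Rightarrow> ('v list \<Rightarrow>\<^sub>0 'r::{comm_ring, comm_monoid_mult})" where
  "cons_chain v = chain_extend (\<lambda>p. basis (v # p))"

text \<open>Unlike \<open>chain_push\<close>, this keeps images that are not regular as basis
  elements, so that the homotopy identity can be proved before degenerate chains are
  discarded.\<close>

definition map_chain ::
  "('v \<Rightarrow> 'w) \<Rightarrow> ('v list \<Rightarrow>\<^sub>0 'r) \<Rightarrow> ('w list \<Rightarrow>\<^sub>0 'r::{comm_ring, comm_monoid_mult})" where
  "map_chain \<phi> = chain_extend (\<lambda>p. basis (map \<phi> p))"

text \<open>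
  The augmented boundary on all lists, including the empty one; without the degree \<open>0\<close> truncation
  the recursion over \<open>v # p\<close> has no exceptional case.
\<close>

primrec face_sum ::
  "('v \<Rightarrow> 'r) \<Rightarrow> 'v list \<Rightarrow> ('v list \<Rightarrow>\<^sub>0 'r::{comm_ring, comm_monoid_mult})" where
  "face_sum \<delta> [] = 0"
| "face_sum \<delta> (v # p) = chain_scale (\<delta> v) (basis p) - cons_chain v (face_sum \<delta> p)"

definition formal_boundary ::
  "('v \<Rightarrow> 'r) \<Rightarrow> ('v list \<Rightarrow>\<^sub>0 'r) \<Rightarrow> ('v list \<Rightarrow>\<^sub>0 'r::{comm_ring, comm_monoid_mult})" where
  "formal_boundary \<delta> = chain_extend (face_sum \<delta>)"

text \<open>
  The term doubling \<open>v\<close> is divided by the weight of \<open>v\<close> (\<open>\<iota> v\<close> is its inverse): its two faces that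
  omit a copy of \<open>v\<close> carry this weight, and have to telescope.
\<close>

primrec prism_sum ::
  "('v \<Rightarrow> 'w) \<Rightarrow> ('v \<Rightarrow> 'w) \<Rightarrow> ('v \<Rightarrow> 'r) \<Rightarrow> 'v list \<Rightarrow>
     ('w list \<Rightarrow>\<^sub>0 'r::{comm_ring, comm_monoid_mult})" where
  "prism_sum \<phi> \<psi> \<iota> [] = 0"
| "prism_sum \<phi> \<psi> \<iota> (v # p) =
     chain_scale (\<iota> v) (basis (\<phi> v # \<psi> v # map \<psi> p)) - cons_chain (\<phi> v) (prism_sum \<phi> \<psi> \<iota> p)"

definition prism ::
  "('v \<Rightarrow> 'w) \<Rightarrow> ('v \<Rightarrow> 'w) \<Rightarrow> ('v \<Rightarrow> 'r) \<Rightarrow> ('v list \<Rightarrow>\<^sub>0 'r) \<Rightarrow>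
     ('w list \<Rightarrow>\<^sub>0 'r::{comm_ring, comm_monoid_mult})" where
  "prism \<phi> \<psi> \<iota> = chain_extend (prism_sum \<phi> \<psi> \<iota>)"

section \<open>Linearity and recursion rules of the formal operators\<close>

lemma cons_chain_basis [simp]: "cons_chain v (basis p) = basis (v # p)"
  and map_chain_basis [simp]: "map_chain \<phi> (basis p) = basis (map \<phi> p)"
  and formal_boundary_basis [simp]: "formal_boundary \<delta> (basis p) = face_sum \<delta> p"
  and prism_basis [simp]: "prism \<phi> \<psi> \<iota> (basis p) = prism_sum \<phi> \<psi> \<iota> p"
  by (simp_all add: cons_chain_def map_chain_def formal_boundary_def prism_def)

lemma zero_chain_maps [simp]:
  "cons_chain v 0 = 0" "map_chain \<phi> 0 = 0" "formal_boundary \<delta> 0 = 0" "prism \<phi> \<psi> \<iota> 0 = 0"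
  by (simp_all add: cons_chain_def map_chain_def formal_boundary_def prism_def)

text \<open>The first four facts of \<open>chain_linear\<close> are about
  \<open>chain_extend\<close>; folding transfers them to the four operators.\<close>

lemmas chain_maps_linear =
  chain_linear
  chain_linear(1-4)[where \<phi> = "\<lambda>p. basis (v # p)" for v, folded cons_chain_def]
  chain_linear(1-4)[where \<phi> = "\<lambda>p. basis (map \<phi> p)" for \<phi>, folded map_chain_def]
  chain_linear(1-4)[where \<phi> = "face_sum \<delta>" for \<delta>, folded formal_boundary_def]
  chain_linear(1-4)[where \<phi> = "prism_sum \<phi> \<psi> \<iota>" for \<phi> \<psi> \<iota>, folded prism_def]

lemma formal_boundary_cons_chain:
  "formal_boundary \<delta> (cons_chain v c) = chain_scale (\<delta> v) c - cons_chain v (formal_boundary \<delta> c)"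
  by (induction c rule: chain_induct) (simp_all add: chain_maps_linear algebra_simps)

lemma map_chain_cons_chain:
  "map_chain \<phi> (cons_chain v c) = cons_chain (\<phi> v) (map_chain \<phi> c)"
  by (induction c rule: chain_induct) (simp_all add: chain_maps_linear)

lemma prism_cons_chain:
  "prism \<phi> \<psi> \<iota> (cons_chain v c) =
     chain_scale (\<iota> v) (cons_chain (\<phi> v) (cons_chain (\<psi> v) (map_chain \<psi> c)))
     - cons_chain (\<phi> v) (prism \<phi> \<psi> \<iota> c)"
  by (induction c rule: chain_induct) (simp_all add: chain_maps_linear algebra_simps)

text \<open>By the cone formula \<open>formal_boundary_cons_chain\<close> the two terms
  \<open>\<delta> v\<close> times the boundary of \<open>p\<close> cancel, and the induction
  hypothesis removes the rest.\<close>

lemma formal_boundary_face_sum: "formal_boundary \<delta> (face_sum \<delta> p) = 0"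
  by (induction p) (simp_all add: chain_maps_linear formal_boundary_cons_chain)

lemma formal_boundary_formal_boundary: "formal_boundary \<delta> (formal_boundary \<delta> c) = 0"
  by (induction c rule: chain_induct) (simp_all add: chain_maps_linear formal_boundary_face_sum)

section \<open>The homotopy identity on arbitrary lists\<close>

lemma face_sum_map:
  assumes "\<And>v. v \<in> set p \<Longrightarrow> \<delta>' (\<phi> v) = \<delta> v"
  shows "face_sum \<delta>' (map \<phi> p) = map_chain \<phi> (face_sum \<delta> p)"
  using assms by (induction p) (simp_all add: chain_maps_linear map_chain_cons_chain)

lemma prism_homotopy_sum:
  assumes "\<And>v. v \<in> set p \<Longrightarrow> \<delta>' (\<phi> v) = \<delta> v" "\<And>v. v \<in> set p \<Longrightarrow> \<delta>' (\<psi> v) = \<delta> v"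
    and "\<And>v. v \<in> set p \<Longrightarrow> \<delta> v * \<iota> v = 1"
  shows "formal_boundary \<delta>' (prism_sum \<phi> \<psi> \<iota> p) + prism \<phi> \<psi> \<iota> (face_sum \<delta> p)
    = basis (map \<psi> p) - basis (map \<phi> p)"
  using assms
proof (induction p)
  case (Cons v p)
  let ?P = "prism_sum \<phi> \<psi> \<iota> p" and ?dp = "face_sum \<delta> p"
  have IH: "formal_boundary \<delta>' ?P + prism \<phi> \<psi> \<iota> ?dp = basis (map \<psi> p) - basis (map \<phi> p)"
    by (rule Cons.IH) (use Cons.prems in auto)
  have w: "\<delta>' (\<phi> v) = \<delta> v" "\<delta>' (\<psi> v) = \<delta> v" "\<iota> v * \<delta> v = 1"
    using Cons.prems by (auto simp: mult.commute)
  have dmap: "face_sum \<delta>' (map \<psi> p) = map_chain \<psi> ?dp"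
    by (rule face_sum_map) (use Cons.prems in auto)
  \<comment> \<open>The first two faces of the doubled term have coefficient
    \<open>\<iota> v * \<delta> v = 1\<close> up to sign. Its other faces cancel by
    \<open>dmap\<close> against the doubled terms in the prism of \<open>cons_chain v ?dp\<close>,
    and the two multiples \<open>\<delta> v\<close> of \<open>?P\<close> cancel as well.\<close>
  have "formal_boundary \<delta>' (prism_sum \<phi> \<psi> \<iota> (v # p)) + prism \<phi> \<psi> \<iota> (face_sum \<delta> (v # p))
    = basis (\<psi> v # map \<psi> p) - basis (\<phi> v # map \<psi> p)
      + cons_chain (\<phi> v) (formal_boundary \<delta>' ?P + prism \<phi> \<psi> \<iota> ?dp)"
    by (simp add: chain_maps_linear formal_boundary_cons_chain prism_cons_chain w dmap)
  \<comment> \<open>By \<open>IH\<close> the last summand is \<open>basis (\<phi> v # map \<psi> p)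
    - basis (\<phi> v # map \<phi> p)\<close>, so the mixed list telescopes.\<close>
  also have "\<dots> = basis (map \<psi> (v # p)) - basis (map \<phi> (v # p))"
    by (simp add: IH chain_maps_linear)
  finally show ?case .
qed simp

lemma prism_homotopy:
  assumes "\<And>p. p \<in> Poly_Mapping.keys c \<Longrightarrow> set p \<subseteq> S"
    and "\<And>v. v \<in> S \<Longrightarrow> \<delta>' (\<phi> v) = \<delta> v" "\<And>v. v \<in> S \<Longrightarrow> \<delta>' (\<psi> v) = \<delta> v"
    and "\<And>v. v \<in> S \<Longrightarrow> \<delta> v * \<iota> v = 1"
  shows "formal_boundary \<delta>' (prism \<phi> \<psi> \<iota> c) + prism \<phi> \<psi> \<iota> (formal_boundary \<delta> c)
    = map_chain \<psi> c - map_chain \<phi> c"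
proof (induction c rule: chain_induct)
  case (basis p r)
  have "formal_boundary \<delta>' (prism_sum \<phi> \<psi> \<iota> p) + prism \<phi> \<psi> \<iota> (face_sum \<delta> p)
    = basis (map \<psi> p) - basis (map \<phi> p)"
    by (rule prism_homotopy_sum) (use assms(1)[OF basis] assms(2-) in auto)
  then show ?case
    by (simp add: chain_maps_linear flip: chain_scale_add chain_scale_diff)
next
  case (add a b)
  have "formal_boundary \<delta>' (prism \<phi> \<psi> \<iota> (a + b)) + prism \<phi> \<psi> \<iota> (formal_boundary \<delta> (a + b))
    = (formal_boundary \<delta>' (prism \<phi> \<psi> \<iota> a) + prism \<phi> \<psi> \<iota> (formal_boundary \<delta> a))
      + (formal_boundary \<delta>' (prism \<phi> \<psi> \<iota> b) + prism \<phi> \<psi> \<iota> (formal_boundary \<delta> b))"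
    by (simp add: chain_maps_linear algebra_simps)
  then show ?case
    by (simp add: add chain_maps_linear)
qed simp

section \<open>Passage to regular chains\<close>

text \<open>A projection whose kernel is the degenerate chains: it realises the convention that
  non-regular basis elements are 0 without forming a quotient.\<close>

definition regular_part ::
  "('v list \<Rightarrow>\<^sub>0 'r) \<Rightarrow> ('v list \<Rightarrow>\<^sub>0 'r::{comm_ring, comm_monoid_mult})" where
  "regular_part = chain_extend path_elem"

definition degenerate :: "('v list \<Rightarrow>\<^sub>0 'r::zero) \<Rightarrow> bool" where
  "degenerate c \<longleftrightarrow> Poly_Mapping.keys c \<subseteq> {p. \<not> distinct_adj p}"

lemma lookup_regular_part:
  "Poly_Mapping.lookup (regular_part c) p = (if distinct_adj p then Poly_Mapping.lookup c p else 0)"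
proof (induction c rule: chain_induct)
  case (basis q r)
  show ?case
    by (simp add: regular_part_def chain_linear path_elem_def lookup_single when_def)
qed (simp_all add: regular_part_def chain_linear lookup_add)

lemma keys_regular_part:
  "Poly_Mapping.keys (regular_part c) = Poly_Mapping.keys c \<inter> {p. distinct_adj p}"
  by (auto simp: in_keys_iff lookup_regular_part split: if_splits)

lemma regular_part_eq_0_iff: "regular_part c = 0 \<longleftrightarrow> degenerate c"
  unfolding degenerate_def keys_eq_empty[symmetric] keys_regular_part by blast

lemma regular_part_add: "regular_part (a + b) = regular_part a + regular_part b"
  and regular_part_diff: "regular_part (a - b) = regular_part a - regular_part b"
  by (simp_all add: regular_part_def chain_linear)

lemma degenerate_diff_regular_part: "degenerate (c - regular_part c)"
  by (auto simp: degenerate_def in_keys_iff lookup_minus lookup_regular_part split: if_splits)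

text \<open>If two neighbouring vertices agree, omitting either one gives the same list with the
  same weight and opposite signs; every other face keeps the repetition.\<close>

lemma degenerate_face_sum:
  assumes "\<not> distinct_adj p"
  shows "degenerate (face_sum \<delta> p)"
  using assms
proof (induction p)
  case (Cons v p)
  note cons_deg = keys_chain_extend[of _ "\<lambda>p. basis (v # p)", folded cons_chain_def]
  show ?case
  proof (cases "distinct_adj p")
    case True
    with Cons.prems obtain q where q: "p = v # q"
      by (cases p) auto
    \<comment> \<open>The repetition is at the head: the two faces omitting a copy of
      \<open>v\<close> cancel, and both copies stay in front of the faces of
      \<open>q\<close>.\<close>
    have "face_sum \<delta> (v # p) = cons_chain v (cons_chain v (face_sum \<delta> q))"
      by (simp add: q chain_maps_linear)
    also have "\<dots> = chain_extend (\<lambda>r. basis (v # v # r)) (face_sum \<delta> q)"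
      by (simp add: cons_chain_def chain_extend_comp)
    finally show ?thesis
      unfolding degenerate_def by (auto intro!: keys_chain_extend split: if_splits)
  next
    case False
    with Cons.IH have IH: "degenerate (face_sum \<delta> p)"
      by simp
    show ?thesis
      unfolding degenerate_def face_sum.simps cons_chain_def
      by (intro keys_chain_diff keys_chain_extend subset_trans[OF keys_chain_scale])
        (use False IH in \<open>auto simp: degenerate_def dest: distinct_adj_ConsD\<close>)
  qed
qed simp

text \<open>The index \<open>s\<close> is the position of the doubled vertex: \<open>p ! s\<close>
  ends the first part and starts the second.\<close>

lemma keys_prism_sum:
  "Poly_Mapping.keys (prism_sum \<phi> \<psi> \<iota> p)
    \<subseteq> {map \<phi> (take (Suc s) p) @ map \<psi> (drop s p) | s. s < length p}"
proof (induction p)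
  case (Cons v p)
  show ?case
    unfolding prism_sum.simps cons_chain_def
  proof (intro keys_chain_diff keys_chain_extend subset_trans[OF keys_chain_scale])
    show "Poly_Mapping.keys (basis (\<phi> v # \<psi> v # map \<psi> p))
      \<subseteq> {map \<phi> (take (Suc s) (v # p)) @ map \<psi> (drop s (v # p)) | s. s < length (v # p)}"
      by (auto intro: exI[of _ 0])
  next
    fix q assume "q \<in> Poly_Mapping.keys (prism_sum \<phi> \<psi> \<iota> p)"
    with Cons obtain s where "q = map \<phi> (take (Suc s) p) @ map \<psi> (drop s p)" "s < length p"
      by blast
    then show "Poly_Mapping.keys (basis (\<phi> v # q))
      \<subseteq> {map \<phi> (take (Suc s) (v # p)) @ map \<psi> (drop s (v # p)) | s. s < length (v # p)}"
      by (auto intro!: exI[of _ "Suc s"])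
  qed
qed simp

text \<open>In contrast to the boundary, each single term keeps the repetition: the equal neighbours
  lie together in the first or together in the second part.\<close>

lemma degenerate_prism_sum:
  assumes "\<not> distinct_adj p"
  shows "degenerate (prism_sum \<phi> \<psi> \<iota> p)"
proof -
  have "\<not> distinct_adj (map \<phi> (take (Suc s) p) @ map \<psi> (drop s p))" for s
  proof -
    obtain i where i: "Suc i < length p" "p ! i = p ! Suc i"
      using assms by (auto simp: distinct_adj_conv_nth)
    let ?q = "map \<phi> (take (Suc s) p) @ map \<psi> (drop s p)"
    show ?thesis
    proof (cases "Suc i \<le> s")
      case True
      then have "?q ! i = \<phi> (p ! i)" "?q ! Suc i = \<phi> (p ! Suc i)" "Suc i < length ?q"
        using i by (auto simp: nth_append)
      then show ?thesis
        using i by (auto simp: distinct_adj_conv_nth)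
    next
      case False
      \<comment> \<open>As \<open>s \<le> i\<close>, both vertices lie in the second part, one place
        further right because \<open>p ! s\<close> occurs twice.\<close>
      then have "?q ! Suc i = \<psi> (p ! i)" "?q ! Suc (Suc i) = \<psi> (p ! Suc i)"
          "Suc (Suc i) < length ?q"
        using i by (auto simp: nth_append Suc_diff_le)
      then show ?thesis
        using i by (metis distinct_adj_conv_nth)
    qed
  qed
  then show ?thesis
    unfolding degenerate_def using keys_prism_sum[of \<phi> \<psi> \<iota> p] by fast
qed

lemma degenerate_formal_boundary: "degenerate c \<Longrightarrow> degenerate (formal_boundary \<delta> c)"
  unfolding degenerate_def formal_boundary_def
  by (intro keys_chain_extend) (use degenerate_face_sum in \<open>unfold degenerate_def, blast\<close>)

lemma degenerate_prism: "degenerate c \<Longrightarrow> degenerate (prism \<phi> \<psi> \<iota> c)"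
  unfolding degenerate_def prism_def
  by (intro keys_chain_extend) (use degenerate_prism_sum in \<open>unfold degenerate_def, blast\<close>)

text \<open>The discarded part of \<open>c\<close> is degenerate and so is its boundary; hence the
  boundary descends to regular chains.\<close>

lemma regular_part_formal_boundary:
  "regular_part (formal_boundary \<delta> (regular_part c)) = regular_part (formal_boundary \<delta> c)"
proof -
  have "degenerate (formal_boundary \<delta> (c - regular_part c))"
    by (intro degenerate_formal_boundary degenerate_diff_regular_part)
  then have "regular_part (formal_boundary \<delta> c - formal_boundary \<delta> (regular_part c)) = 0"
    by (simp add: regular_part_eq_0_iff chain_maps_linear)
  then show ?thesis
    by (simp add: regular_part_diff)
qed

section \<open>Comparison with \<open>chain_push\<close> and \<open>wboundary\<close>\<close>

lemma chain_push_eq: "chain_push \<phi> c = regular_part (map_chain \<phi> c)"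
  by (simp add: chain_push_def regular_part_def map_chain_def chain_extend_comp)

text \<open>Prefixing \<open>v\<close> moves every omitted position up by one, which accounts for
  the sign in the recursion.\<close>

lemma face_sum_eq:
  "face_sum \<delta> p =
     (\<Sum>s<length p. chain_scale ((- 1) ^ s * \<delta> (p ! s)) (basis (take s p @ drop (Suc s) p)))"
proof (induction p)
  case (Cons v p)
  show ?case
    by (simp add: Cons sum.lessThan_Suc_shift chain_maps_linear chain_scale_uminus_left
        sum_negf del: sum.lessThan_Suc)
qed simp

text \<open>Positive degree matters: the formal boundary of \<open>[v]\<close> is a multiple of the
  empty list, which counts as regular, whereas \<open>wboundary\<close> vanishes in degree 0. The
  length condition matches the ranges \<open>s \<le> n\<close> and
  \<open>s < length p\<close>.\<close>

lemma wboundary_eq: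
  assumes "n > 0" "\<And>p. p \<in> Poly_Mapping.keys c \<Longrightarrow> length p = Suc n"
  shows "wboundary \<delta> n c = regular_part (formal_boundary \<delta> c)"
proof -
  have "chain_extend
      (\<lambda>p. \<Sum>s\<le>n. chain_scale ((- 1) ^ s * \<delta> (p ! s)) (path_elem (take s p @ drop (Suc s) p))) c
    = chain_extend (\<lambda>p. regular_part (face_sum \<delta> p)) c"
    unfolding chain_extend_def
    by (rule sum.cong)
      (use assms(2) in \<open>simp_all add: face_sum_eq regular_part_def chain_extend_sum
        chain_extend_scale lessThan_Suc_atMost\<close>)
  then show ?thesis
    using assms(1) by (simp add: wboundary_def regular_part_def formal_boundary_def chain_extend_comp)
qed

section \<open>Homotopy invariance\<close>

lemma reg_chains_add: "a \<in> reg_chains n P \<Longrightarrow> b \<in> reg_chains n P \<Longrightarrow> a + b \<in> reg_chains n P"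
  and reg_chains_diff: "a \<in> reg_chains n P \<Longrightarrow> b \<in> reg_chains n P \<Longrightarrow> a - b \<in> reg_chains n P"
  unfolding reg_chains_def by (simp_all add: keys_chain_add keys_chain_diff)

lemma regular_part_in_reg_chains:
  assumes "\<And>p. p \<in> Poly_Mapping.keys c \<Longrightarrow> p \<in> P \<and> length p = Suc n"
  shows "regular_part c \<in> reg_chains n P"
  using assms by (auto simp: reg_chains_def keys_regular_part)

lemma wboundary_add: "wboundary \<delta> n (a + b) = wboundary \<delta> n a + wboundary \<delta> n b"
  and wboundary_diff: "wboundary \<delta> n (a - b) = wboundary \<delta> n a - wboundary \<delta> n b"
  by (simp_all add: wboundary_def chain_linear)

lemma wboundary_wboundary:
  assumes "c \<in> Omega C (Suc n)"
  shows "wboundary (pweight C) n (wboundary (pweight C) (Suc n) c) = 0"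
proof (cases "n = 0")
  case False
  have c: "c \<in> reg_chains (Suc n) (ppaths C)"
    and dc: "wboundary (pweight C) (Suc n) c \<in> reg_chains n (ppaths C)"
    using assms by (auto simp: Omega_def)
  have eq: "wboundary (pweight C) (Suc n) c = regular_part (formal_boundary (pweight C) c)"
    by (rule wboundary_eq) (use c in \<open>auto simp: reg_chains_def\<close>)
  have "wboundary (pweight C) n (wboundary (pweight C) (Suc n) c)
    = regular_part (formal_boundary (pweight C) (wboundary (pweight C) (Suc n) c))"
    by (rule wboundary_eq) (use False dc in \<open>auto simp: reg_chains_def\<close>)
  also have "\<dots> = 0"
    by (simp add: eq regular_part_formal_boundary formal_boundary_formal_boundary)
      (simp add: regular_part_def)
  finally show ?thesis .
qed (simp add: wboundary_def)

section \<open>Boundaries, homology classes and cosets\<close>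

lemma boundaries_add: "a \<in> boundaries C n \<Longrightarrow> b \<in> boundaries C n \<Longrightarrow> a + b \<in> boundaries C n"
  and boundaries_diff: "a \<in> boundaries C n \<Longrightarrow> b \<in> boundaries C n \<Longrightarrow> a - b \<in> boundaries C n"
proof -
  have "x + y \<in> Omega C (Suc n)" "x - y \<in> Omega C (Suc n)"
    if "x \<in> Omega C (Suc n)" "y \<in> Omega C (Suc n)" for x y
    using that by (auto simp: Omega_def wboundary_add wboundary_diff reg_chains_add reg_chains_diff)
  then show "a \<in> boundaries C n \<Longrightarrow> b \<in> boundaries C n \<Longrightarrow> a + b \<in> boundaries C n"
    and "a \<in> boundaries C n \<Longrightarrow> b \<in> boundaries C n \<Longrightarrow> a - b \<in> boundaries C n"
    unfolding boundaries_def
    by (auto simp flip: wboundary_add wboundary_diff)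
qed

text \<open>An element of a class is a boundary plus a cycle, so whichever representative enters the
  union in \<open>path_homology_map\<close> is itself a cycle.\<close>

lemma homology_class_cycle:
  assumes X: "X \<in> carrier (path_homology C n)" and z: "z \<in> X"
  shows "z \<in> reg_chains n (ppaths C)" and "wboundary (pweight C) n z = 0"
proof -
  obtain c where c: "c \<in> carrier (cycle_group C n)" and "X = boundaries C n #>\<^bsub>cycle_group C n\<^esub> c"
    using X by (auto simp: path_homology_def FactGroup_def RCOSETS_def)
  then obtain w where w: "w \<in> Omega C (Suc n)" and "z = wboundary (pweight C) (Suc n) w + c"
    using z by (auto simp: r_coset_def cycle_group_def boundaries_def)
  moreover have "wboundary (pweight C) (Suc n) w \<in> reg_chains n (ppaths C)"
    using w by (simp add: Omega_def)
  ultimately show "z \<in> reg_chains n (ppaths C)" "wboundary (pweight C) n z = 0"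
    using c
    by (simp_all add: cycle_group_def Omega_def reg_chains_add wboundary_add wboundary_wboundary[OF w])
qed

text \<open>The cosets are translates of \<open>boundaries C n\<close>; shifting the boundary by
  \<open>y - x\<close> gives both inclusions.\<close>

lemma coset_eq_if_diff_boundary:
  assumes "y - x \<in> boundaries C n"
  shows "boundaries C n #>\<^bsub>cycle_group C n\<^esub> x = boundaries C n #>\<^bsub>cycle_group C n\<^esub> y"
proof -
  have "b + x \<in> (\<lambda>b. b + y) ` boundaries C n" if "b \<in> boundaries C n" for b
    by (rule image_eqI[of _ _ "b - (y - x)"]) (use that assms in \<open>simp_all add: boundaries_diff\<close>)
  moreover have "b + y \<in> (\<lambda>b. b + x) ` boundaries C n" if "b \<in> boundaries C n" for b
    by (rule image_eqI[of _ _ "b + (y - x)"]) (use that assms in \<open>simp_all add: boundaries_add\<close>)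
  ultimately have "(\<lambda>b. b + x) ` boundaries C n = (\<lambda>b. b + y) ` boundaries C n"
    by blast
  then show ?thesis
    by (auto simp: r_coset_def cycle_group_def)
qed

text \<open>This disposes of the summand \<open>L \<partial> z\<close> of the homotopy identity. In
  positive degree the formal boundary of a cycle is degenerate and the prism preserves this. In
  degree 0 it is a multiple of the empty list, on which \<open>prism_sum\<close> is 0.\<close>

lemma degenerate_prism_boundary_of_cycle:
  assumes z: "z \<in> reg_chains n P" and dz: "wboundary \<delta> n z = 0"
  shows "degenerate (prism \<phi> \<psi> \<iota> (formal_boundary \<delta> z))"
proof (cases "n = 0")
  case True
  have "prism \<phi> \<psi> \<iota> (formal_boundary \<delta> z) = 0"
  proof (induction z rule: chain_induct)
    case (basis p r)
    then have "length p = 1"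
      using z True by (auto simp: reg_chains_def)
    then obtain v where "p = [v]"
      by (auto simp: length_Suc_conv)
    then show ?case
      by (simp add: chain_maps_linear)
  qed (simp_all add: chain_maps_linear)
  then show ?thesis
    by (simp add: degenerate_def)
next
  case False
  have "wboundary \<delta> n z = regular_part (formal_boundary \<delta> z)"
    by (rule wboundary_eq) (use False z in \<open>auto simp: reg_chains_def\<close>)
  then show ?thesis
    using dz by (simp add: regular_part_eq_0_iff degenerate_prism)
qed

lemma chain_push_in_reg_chains:
  assumes "weighted_path_morphism C D \<phi>" "z \<in> reg_chains n (ppaths C)"
  shows "chain_push \<phi> z \<in> reg_chains n (ppaths D)"
proof -
  have "Poly_Mapping.keys (map_chain \<phi> z) \<subseteq> {p \<in> ppaths D. length p = Suc n}"
    unfolding map_chain_def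
    by (rule keys_chain_extend)
      (use assms in \<open>auto simp: weighted_path_morphism_def reg_chains_def split: if_splits\<close>)
  then show ?thesis
    unfolding chain_push_eq by (intro regular_part_in_reg_chains) auto
qed

lemma chain_push_diff_boundary:
  fixes C :: "('v, 'r::{comm_ring, comm_monoid_mult}) wpath_complex"
  assumes C: "path_complex C"
    and \<phi>: "weighted_path_morphism C D \<phi>" and \<psi>: "weighted_path_morphism C D \<psi>"
    and prism_paths: "\<And>p s. p \<in> ppaths C \<Longrightarrow> s < length p \<Longrightarrow>
      map \<phi> (take (Suc s) p) @ map \<psi> (drop s p) \<in> ppaths D"
    and unit: "\<And>v. v \<in> pverts C \<Longrightarrow> \<exists>l. pweight C v * l = 1"
    and z: "z \<in> reg_chains n (ppaths C)" and dz: "wboundary (pweight C) n z = 0"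
  shows "chain_push \<psi> z - chain_push \<phi> z \<in> boundaries D n"
proof -
  obtain \<iota> where \<iota>: "pweight C v * \<iota> v = 1" if "v \<in> pverts C" for v
    using unit by metis
  let ?L = "prism \<phi> \<psi> \<iota> z"
  have keysL: "Poly_Mapping.keys ?L \<subseteq> {p \<in> ppaths D. length p = Suc (Suc n)}"
    unfolding prism_def
  proof (rule keys_chain_extend)
    fix p assume "p \<in> Poly_Mapping.keys z"
    with z have p: "p \<in> ppaths C" "length p = Suc n"
      by (auto simp: reg_chains_def)
    show "Poly_Mapping.keys (prism_sum \<phi> \<psi> \<iota> p) \<subseteq> {p \<in> ppaths D. length p = Suc (Suc n)}"
      by (rule subset_trans[OF keys_prism_sum]) (use p prism_paths[OF p(1)] in auto)
  qed
  have "formal_boundary (pweight D) ?L + prism \<phi> \<psi> \<iota> (formal_boundary (pweight C) z)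
      = map_chain \<psi> z - map_chain \<phi> z"
    by (rule prism_homotopy[where S = "pverts C"])
      (use z C \<phi> \<psi> \<iota> in \<open>auto simp: reg_chains_def path_complex_def weighted_path_morphism_def\<close>)
  \<comment> \<open>Applying \<open>regular_part\<close> removes the prism of the boundary and turns
    \<open>map_chain\<close> into \<open>chain_push\<close>.\<close>
  then have "regular_part (formal_boundary (pweight D) ?L) = chain_push \<psi> z - chain_push \<phi> z"
    using degenerate_prism_boundary_of_cycle[OF z dz, of \<phi> \<psi> \<iota>]
    by (metis add.right_neutral chain_push_eq regular_part_add regular_part_diff
        regular_part_eq_0_iff)
  moreover have L: "regular_part ?L \<in> reg_chains (Suc n) (ppaths D)"
    by (rule regular_part_in_reg_chains) (use keysL in auto)
  moreover have "wboundary (pweight D) (Suc n) (regular_part ?L)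
      = regular_part (formal_boundary (pweight D) ?L)"
    by (subst wboundary_eq) (use L in \<open>auto simp: reg_chains_def regular_part_formal_boundary\<close>)
  ultimately have d: "wboundary (pweight D) (Suc n) (regular_part ?L)
      = chain_push \<psi> z - chain_push \<phi> z"
    by simp
  \<comment> \<open>\<open>Omega\<close> also demands that the boundary be supported on paths of
    \<open>D\<close>; by \<open>d\<close> this boundary is a difference of two pushed chains, which
    are.\<close>
  have "chain_push \<psi> z - chain_push \<phi> z \<in> reg_chains n (ppaths D)"
    using chain_push_in_reg_chains[OF \<phi> z] chain_push_in_reg_chains[OF \<psi> z]
    by (rule reg_chains_diff[rotated])
  then have "regular_part ?L \<in> Omega D (Suc n)"
    using L d by (simp add: Omega_def)
  then show ?thesis
    unfolding boundaries_def d[symmetric] by (rule imageI)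
qed

lemma path_homology_map_eq:
  fixes C :: "('v, 'r::{comm_ring, comm_monoid_mult}) wpath_complex"
  assumes "path_complex C" "weighted_path_morphism C D \<phi>" "weighted_path_morphism C D \<psi>"
    and "\<And>p s. p \<in> ppaths C \<Longrightarrow> s < length p \<Longrightarrow>
      map \<phi> (take (Suc s) p) @ map \<psi> (drop s p) \<in> ppaths D"
    and "\<And>v. v \<in> pverts C \<Longrightarrow> \<exists>l. pweight C v * l = 1"
  shows "path_homology_map C D \<phi> n = path_homology_map C D \<psi> n"
  unfolding path_homology_map_def
\<comment> \<open>Both maps have the same domain and their unions run over the same representatives,
  so cosets are compared one by one.\<close>
proof (rule restrict_ext, rule SUP_cong[OF refl])
  fix X z
  assume "X \<in> carrier (path_homology C n)" "z \<in> X"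
  then show "boundaries D n #>\<^bsub>cycle_group D n\<^esub> chain_push \<phi> z
      = boundaries D n #>\<^bsub>cycle_group D n\<^esub> chain_push \<psi> z"
    using assms by (intro coset_eq_if_diff_boundary chain_push_diff_boundary homology_class_cycle)
qed

section \<open>From hypergraph homotopies to path complexes\<close>

lemma Dw_Nw_simps:
  "pverts (Dw (Nw G)) = P01 G"
  "ppaths (Dw (Nw G)) =
     {p. p \<noteq> [] \<and> set p \<subseteq> P01 G \<and> successively (\<lambda>x y. (x, y) \<in> harrows G) p}"
  "pweight (Dw (Nw G)) = set_weight G"
  by (simp_all add: Dw_def Nw_def)

lemma edge_homology_map_eq_of_arrows:
  fixes G :: "('a, 'r::{comm_ring, comm_monoid_mult}) wdir_hypergraph"
  assumes G: "directed_hypergraph G"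
    and f: "edge_weighted_morphism G H f" and g: "edge_weighted_morphism G H g"
    and arrow: "\<And>A. A \<in> P01 G \<Longrightarrow> (fst f ` A, fst g ` A) \<in> harrows H"
    and unit: "\<And>A. A \<in> P01 G \<Longrightarrow> \<exists>l. set_weight G A * l = 1"
  shows "edge_homology_map G H f n = edge_homology_map G H g n"
  unfolding edge_homology_map_def
proof (rule path_homology_map_eq)
  let ?f = "\<lambda>C. fst f ` C" and ?g = "\<lambda>C. fst g ` C"
  show F: "weighted_path_morphism (Dw (Nw G)) (Dw (Nw H)) ?f"
    and K: "weighted_path_morphism (Dw (Nw G)) (Dw (Nw H)) ?g"
    using f g by (auto intro: weighted_path_morphism_Dw_Nw)
  fix p s assume p: "p \<in> ppaths (Dw (Nw G))" and s: "s < length p"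
  have "map ?f p \<in> ppaths (Dw (Nw H))" "map ?g p \<in> ppaths (Dw (Nw H))"
    using F K p by (auto simp: weighted_path_morphism_def)
  \<comment> \<open>A prefix of one image path and a suffix of the other are joined by the arrow at
    \<open>p ! s\<close>.\<close>
  moreover have "map ?f p = map ?f (take (Suc s) p) @ map ?f (drop (Suc s) p)"
    "map ?g p = map ?g (take s p) @ map ?g (drop s p)"
    by (simp_all flip: map_append)
  moreover have "(fst f ` (p ! s), fst g ` (p ! s)) \<in> harrows H"
    by (rule arrow) (use p s in \<open>auto simp: Dw_Nw_simps\<close>)
  moreover have "last (map ?f (take (Suc s) p)) = fst f ` (p ! s)"
    "hd (map ?g (drop s p)) = fst g ` (p ! s)" "take (Suc s) p \<noteq> []" "drop s p \<noteq> []"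
    using s by (auto simp: take_Suc_conv_app_nth hd_map hd_drop_conv_nth)
  ultimately show "map ?f (take (Suc s) p) @ map ?g (drop s p) \<in> ppaths (Dw (Nw H))"
    unfolding Dw_Nw_simps mem_Collect_eq by (metis (no_types, lifting) Nil_is_append_conv
      Nil_is_map_conv Un_subset_iff set_append successively_append_iff)
qed (use path_complex_Dw_Nw[OF G] unit in \<open>auto simp: Dw_Nw_simps\<close>)

text \<open>The homotopy sends the arrow between the two copies of \<open>A\<close> in the box
  product to an arrow of \<open>H\<close>; the two cases are the two orientations of the
  interval.\<close>

lemma one_step_homotopic_arrows:
  assumes G: "directed_hypergraph G" and "one_step_homotopic G H f0 f1"
  obtains "\<And>A. A \<in> P01 G \<Longrightarrow> (fst f0 ` A, fst f1 ` A) \<in> harrows H"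
  | "\<And>A. A \<in> P01 G \<Longrightarrow> (fst f1 ` A, fst f0 ` A) \<in> harrows H"
proof -
  obtain I F where I: "I \<in> {(0, 1), (1, 0)}" and F: "hmorphism (box_I G I) H F"
    and f0: "box_restrict G 0 F = f0" and f1: "box_restrict G 1 F = f1"
    using assms(2) by (auto simp: one_step_homotopic_def)
  have sub: "A \<subseteq> hverts G" if "A \<in> P01 G" for A
    using G that by (fastforce simp: directed_hypergraph_def P01_def)
  \<comment> \<open>\<open>box_restrict\<close> is tied to \<open>F\<close> only on vertices of
    \<open>G\<close>, so \<open>A\<close> has to consist of such vertices.\<close>
  have img: "fst F ` (A \<times> {k}) = fst (box_restrict G k F) ` A" if "A \<in> P01 G" for A k
    using sub[OF that] by (force simp: box_restrict_def)
  have arrow: "(fst F ` (A \<times> {fst I}), fst F ` (A \<times> {snd I})) \<in> harrows H" if "A \<in> P01 G" for A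
  proof -
    have "(A \<times> {fst I}, A \<times> {snd I}) \<in> harrows (box_I G I)"
      using that by (auto simp: box_I_def split: prod.split)
    then show ?thesis
      using F unfolding hmorphism_def by (metis (mono_tags, lifting) PiE_mem case_prodD)
  qed
  from I show thesis
    using that arrow by (auto simp: img f0 f1[unfolded One_nat_def])
qed

theorem theorem3p7:
  fixes G :: "('a, 'r::{comm_ring, comm_monoid_mult}) wdir_hypergraph"
    and H :: "('b, 'r) wdir_hypergraph"
    and f g :: "('a, 'b) hmap"
  assumes "directed_hypergraph G" and "directed_hypergraph H"
    and "edge_weighted_morphism G H f" and "edge_weighted_morphism G H g"
    and "edge_weighted_homotopic G H f g"
    and "\<forall>k \<in> {k. \<exists>A \<in> P01 G. k = set_weight G A}. \<exists>l. k * l = 1"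
  shows "\<forall>n. edge_homology_map G H f n = edge_homology_map G H g n"
proof
  fix n
  obtain m h where h: "h 0 = f" "h m = g" "\<And>i. i \<le> m \<Longrightarrow> edge_weighted_morphism G H (h i)"
    and step: "\<And>i. i < m \<Longrightarrow> one_step_homotopic G H (h i) (h (Suc i))"
    using assms(5) by (auto simp: edge_weighted_homotopic_def)
  have unit: "\<exists>l. set_weight G A * l = 1" if "A \<in> P01 G" for A
    using assms(6) that by blast
  have "edge_homology_map G H (h 0) n = edge_homology_map G H (h i) n" if "i \<le> m" for i
    using that
  proof (induction i)
    case (Suc i)
    have mor: "edge_weighted_morphism G H (h i)" "edge_weighted_morphism G H (h (Suc i))"
      using Suc.prems h(3) by auto
    have "one_step_homotopic G H (h i) (h (Suc i))"
      using Suc.prems step by simp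
    from assms(1) this have "edge_homology_map G H (h i) n = edge_homology_map G H (h (Suc i)) n"
    proof (cases rule: one_step_homotopic_arrows)
      case 1
      then show ?thesis
        using assms(1) mor unit by (intro edge_homology_map_eq_of_arrows)
    next
      \<comment> \<open>The arrows run from \<open>h (Suc i)\<close> to \<open>h i\<close>, so the
        two morphisms exchange roles and the resulting equation is reversed.\<close>
      case 2
      then show ?thesis
        using assms(1) mor unit by (intro edge_homology_map_eq_of_arrows[symmetric])
    qed
    then show ?case
      using Suc by simp
  qed simp
  from this[of m] show "edge_homology_map G H f n = edge_homology_map G H g n"
    by (simp add: h)
qed

end
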